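(* Let $N,m,n,r$ be positive integers with $r<m$, let $X\in\mathbb{R}^{N\times m}$, $A\in\mathbb{R}^{m\times r}$, $B\in\mathbb{R}^{r\times n}$, $G\in\mathbb{R}^{N\times n}$, and let $\lambda>0$ and $\eta>0$. Put $Z=XA$, $U=GB^\top$, $\Sigma_X=X^\top X$, $M=(Z^\top Z+\lambda I_r)^{-1}Z^\top X$, and let $\widetilde{\nabla}_A\mathcal{L}=M^\top Z^\top U$ be the reconstructed gradient. Then $A^\top\Sigma_XA+\lambda I_r$ is invertible, and with $K_\lambda=(A^\top\Sigma_XA+\lambda I_r)^{-1}A^\top X^\top U\in\mathbb{R}^{r\times r}$ one has $$\widetilde{\nabla}_A\mathcal{L}=\Sigma_XAK_\lambda .$$ Let $S=\operatorname{Col}(A)$, let $P_S$ be the orthogonal projector of $\mathbb{R}^m$ onto $S$, let $P_S^\perp=I_m-P_S$, and let $A^+=A-\eta\,\widetilde{\nabla}_A\mathcal{L}$. Then $$P_S^\perp A^+=-\eta\,P_S^\perp\Sigma_XAK_\lambda .$$ Consequently, if $P_S^\perp\Sigma_XAK_\lambda\neq 0$, then $\operatorname{Col}(A^+)\nsubseteq\operatorname{Col}(A)$. If in addition $A^+$ has full column rank, then $\operatorname{Col}(A^+)$ is an $r$-dimensional subspace of $\mathbb{R}^m$ different from $\operatorname{Col}(A)$.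
   Context: $\operatorname{Col}(\cdot)$ denotes the column space of a matrix. The setting is a layer $Y=X(W+AB)$ with frozen weight $W\in\mathbb{R}^{m\times n}$, trainable low-rank factors $A,B$, input activation $X$, and upstream gradient $G=\partial\mathcal{L}/\partial Y$ of a loss $\mathcal{L}$. The exact gradient in $A$ is $X^\top GB^\top$. The reconstructed gradient replaces $X$ by $\widehat X=ZM$, i.e. it equals $\widehat X^\top GB^\top=M^\top Z^\top U$. For the claim, $G$ is an arbitrary matrix and $\widetilde{\nabla}_A\mathcal{L}$ is just the name of the matrix $M^\top Z^\top U$. *)

theory Defs
  imports "HOL-Analysis.Analysis"
begin

text \<open>In \<open>real^'n^'m\<close> the outer index \<open>'m\<close> counts rows: this is the type of
  \<open>m \<times> n\<close> matrices.\<close>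

definition col_space :: "real^'n^'m \<Rightarrow> (real^'m) set" where
  "col_space A = span (columns A)"

text \<open>The description determines a matrix only if \<open>S\<close> is a subspace; see
  \<open>orth_projector_ex1\<close>.\<close>

definition orth_projector :: "(real^'m) set \<Rightarrow> real^'m^'m" where
  "orth_projector S =
     (THE P. \<forall>x. P *v x \<in> S \<and> (\<forall>y\<in>S. orthogonal (x - P *v x) y))"

lemma orth_component_unique:
  fixes S :: "(real^'m) set"
  assumes S: "subspace S"
    and a: "a \<in> S" "\<forall>y\<in>S. orthogonal (x - a) y"
    and b: "b \<in> S" "\<forall>y\<in>S. orthogonal (x - b) y"
  shows "a = b"
proof -
  have d: "a - b \<in> S" using S a(1) b(1) by (rule subspace_diff)
  have "(x - b) \<bullet> (a - b) - (x - a) \<bullet> (a - b) = 0"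
    using a(2) b(2) d by (simp add: orthogonal_def)
  then have "(a - b) \<bullet> (a - b) = 0"
    by (simp add: inner_diff_left algebra_simps)
  then show ?thesis by simp
qed

lemma orth_projector_ex1:
  fixes S :: "(real^'m) set"
  assumes S: "subspace S"
  shows "\<exists>!P :: real^'m^'m. \<forall>x. P *v x \<in> S \<and> (\<forall>y\<in>S. orthogonal (x - P *v x) y)"
proof -
  have "\<exists>a. a \<in> S \<and> (\<forall>y\<in>S. orthogonal (x - a) y)" for x
  proof -
    have "span S = S" using S by (simp add: span_eq_iff)
    moreover obtain a c where "a \<in> span S" "\<And>w. w \<in> span S \<Longrightarrow> orthogonal c w" "x = a + c"
      using orthogonal_subspace_decomp_exists[of S x] by metis
    ultimately show ?thesis by (intro exI[of _ a]) (auto simp del: span_eq_iff)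
  qed
  then obtain f where f: "\<And>x. f x \<in> S" "\<And>x y. y \<in> S \<Longrightarrow> orthogonal (x - f x) y"
    by metis
  have "linear f"
  proof
    fix x y :: "real^'m" and c :: real
    show "f (x + y) = f x + f y"
    proof (rule orth_component_unique[OF S, of _ "x + y"])
      show "f x + f y \<in> S" using S f(1) by (simp add: subspace_add)
      show "\<forall>z\<in>S. orthogonal (x + y - (f x + f y)) z"
      proof
        fix z assume "z \<in> S"
        then have "orthogonal ((x - f x) + (y - f y)) z"
          using f(2) by (intro orthogonal_clauses(9))
        then show "orthogonal (x + y - (f x + f y)) z" by (simp add: algebra_simps)
      qed
    qed (use f in auto)
    show "f (c *\<^sub>R x) = c *\<^sub>R f x"
    proof (rule orth_component_unique[OF S, of _ "c *\<^sub>R x"])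
      show "c *\<^sub>R f x \<in> S" using S f(1) by (simp add: subspace_scale)
      show "\<forall>z\<in>S. orthogonal (c *\<^sub>R x - c *\<^sub>R f x) z"
      proof
        fix z assume "z \<in> S"
        then have "orthogonal (c *\<^sub>R (x - f x)) z"
          using f(2) by (intro orthogonal_clauses(7))
        then show "orthogonal (c *\<^sub>R x - c *\<^sub>R f x) z"
          by (simp only: scaleR_right_diff_distrib)
      qed
    qed (use f in auto)
  qed
  then have mf: "matrix f *v x = f x" for x
    by (metis matrix_vector_mul(2))
  show ?thesis
  proof (rule ex1I[of _ "matrix f"])
    show "\<forall>x. matrix f *v x \<in> S \<and> (\<forall>y\<in>S. orthogonal (x - matrix f *v x) y)"
      using f by (simp add: mf)
  next
    fix P :: "real^'m^'m"
    assume P: "\<forall>x. P *v x \<in> S \<and> (\<forall>y\<in>S. orthogonal (x - P *v x) y)"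
    have "P *v x = matrix f *v x" for x
      by (rule orth_component_unique[OF S, of _ x]) (use P f mf in auto)
    then show "P = matrix f" by (simp add: matrix_eq)
  qed
qed

lemma orth_projector:
  fixes S :: "(real^'m) set"
  assumes "subspace S"
  shows "orth_projector S *v x \<in> S"
    and "y \<in> S \<Longrightarrow> orthogonal (x - orth_projector S *v x) y"
  using theI'[OF orth_projector_ex1[OF assms]] unfolding orth_projector_def by blast+

end

theory Submission
  imports Defs
begin

text \<open>Since \<open>Z = X ** A\<close>, the matrices inverted in \<open>M\<close> and in
  \<open>K\<close> are one and the same matrix T. It is symmetric, and positive definite because
  \<open>lam > 0\<close> (\<open>invertible_gram_plus_scaleR\<close>), so its inverse exists and is
  symmetric (\<open>transpose_matrix_inv\<close>). Hence \<open>transpose M\<close> is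
  \<open>transpose X ** X ** A\<close> times the inverse of T, and regrouping the product with
  \<open>transpose Z ** U\<close> gives \<open>SigmaX ** A ** K\<close>. The complementary projector
  kills every matrix whose columns lie in \<open>S\<close>
  (\<open>orth_projector_complement_mul_eq_0\<close>). Applied to \<open>A\<close>, this leaves only
  the gradient term of the update; applied to \<open>A'\<close>, it shows that an update staying
  inside \<open>S\<close> would make that term vanish.\<close>

lemma matrix_inv:
  fixes T :: "'a::semiring_1^'n^'m"
  assumes "invertible T"
  shows matrix_inv_right: "T ** matrix_inv T = mat 1"
    and matrix_inv_left: "matrix_inv T ** T = mat 1"
  using someI_ex[OF assms[unfolded invertible_def]] unfolding matrix_inv_def by auto

lemma transpose_matrix_inv:
  fixes T :: "'a::comm_semiring_1^'n^'m"
  assumes "invertible T"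
  shows "transpose (matrix_inv T) = matrix_inv (transpose T)"
proof -
  have r: "transpose T ** transpose (matrix_inv T) = mat 1"
    and l: "transpose (matrix_inv T) ** transpose T = mat 1"
    using matrix_inv[OF assms] by (metis matrix_transpose_mul transpose_mat)+
  then have "invertible (transpose T)"
    unfolding invertible_def by blast
  then show ?thesis
    by (metis r matrix_inv_left matrix_mul_assoc matrix_mul_lid matrix_mul_rid)
qed

text \<open>The quadratic form of this matrix at x is
  \<open>(Z *v x) \<bullet> (Z *v x) + lam * (x \<bullet> x)\<close>, a sum of two nonnegative
  terms. On a kernel vector both vanish, and \<open>lam > 0\<close> then forces x = 0.\<close>

lemma invertible_gram_plus_scaleR:
  fixes Z :: "real^'r^'N"
  assumes "lam > 0"
  shows "invertible (transpose Z ** Z + lam *\<^sub>R mat 1)"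
  unfolding invertible_left_inverse matrix_left_invertible_ker
proof (intro allI impI)
  fix x :: "real^'r"
  assume z: "(transpose Z ** Z + lam *\<^sub>R mat 1) *v x = 0"
  have "x \<bullet> ((transpose Z ** Z + lam *\<^sub>R mat 1) *v x)
      = x \<bullet> (transpose Z *v (Z *v x)) + lam * (x \<bullet> x)"
    by (simp add: matrix_vector_mult_add_rdistrib inner_add_right matrix_vector_mul_assoc
        scaleR_matrix_vector_assoc[symmetric] del: transpose_matrix_vector)
  also have "x \<bullet> (transpose Z *v (Z *v x)) = (Z *v x) \<bullet> (Z *v x)"
    by (metis dot_lmul_matrix vector_transpose_matrix)
  finally have "(Z *v x) \<bullet> (Z *v x) + lam * (x \<bullet> x) = 0"
    using z by simp
  moreover have "(Z *v x) \<bullet> (Z *v x) \<ge> 0" "lam * (x \<bullet> x) \<ge> 0"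
    using assms by auto
  ultimately have "lam * (x \<bullet> x) = 0"
    by linarith
  then show "x = 0"
    using assms by simp
qed

lemma matrix_diff_ldistrib:
  fixes A :: "'a::ring_1^'n^'m"
  shows "A ** (B - C) = A ** B - A ** C"
  by (simp add: vec_eq_iff matrix_matrix_mult_def right_diff_distrib sum_subtractf)

lemma orth_projector_complement_mul_eq_0:
  fixes A :: "real^'r^'m"
  assumes S: "subspace S" and "col_space A \<subseteq> S"
  shows "(mat 1 - orth_projector S) ** A = 0"
proof -
  have "orth_projector S *v (A *v x) = A *v x" for x
  proof -
    have "A *v x \<in> S"
      using assms(2) matrix_vector_mult_in_columnspace unfolding col_space_def by blast
    then show ?thesis
      \<comment> \<open>A vector of \<open>S\<close> is its own orthogonal component, the residual
        being 0.\<close>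
      using orth_component_unique[OF S] orth_projector[OF S] by (metis diff_self orthogonal_clauses(6))
  qed
  then show ?thesis
    by (simp add: matrix_eq matrix_vector_mul_assoc[symmetric] matrix_vector_mult_diff_rdistrib)
qed

theorem mainTheorem1:
  fixes X :: "real^'m^'N" and A :: "real^'r^'m" and B :: "real^'n^'r" and G :: "real^'n^'N"
    and lam eta :: real
    and Z U :: "real^'r^'N" and SigmaX :: "real^'m^'m" and M :: "real^'m^'r"
    and gradA A' :: "real^'r^'m" and K :: "real^'r^'r"
    and S :: "(real^'m) set" and P_S P_perp :: "real^'m^'m"
  assumes "CARD('r) < CARD('m)"
    and "lam > 0"
    and "eta > 0"
    and "Z = X ** A"
    and "U = G ** transpose B"
    and "SigmaX = transpose X ** X"
    and "M = matrix_inv (transpose Z ** Z + lam *\<^sub>R mat 1) ** transpose Z ** X"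
    and "gradA = transpose M ** transpose Z ** U"
    and "K = matrix_inv (transpose A ** SigmaX ** A + lam *\<^sub>R mat 1)
               ** transpose A ** transpose X ** U"
    and "S = col_space A"
    and "P_S = orth_projector S"
    and "P_perp = mat 1 - P_S"
    and "A' = A - eta *\<^sub>R gradA"
  shows "invertible (transpose A ** SigmaX ** A + lam *\<^sub>R mat 1)
    \<and> gradA = SigmaX ** A ** K
    \<and> P_perp ** A' = - (eta *\<^sub>R (P_perp ** SigmaX ** A ** K))
    \<and> (P_perp ** SigmaX ** A ** K \<noteq> 0 \<longrightarrow>
         \<not> col_space A' \<subseteq> col_space A
         \<and> (rank A' = CARD('r) \<longrightarrow>
              subspace (col_space A') \<and> dim (col_space A') = CARD('r)
              \<and> col_space A' \<noteq> col_space A))"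
proof -
  define T where "T = transpose A ** SigmaX ** A + lam *\<^sub>R mat 1"
  have gram: "T = transpose Z ** Z + lam *\<^sub>R mat 1"
    using assms by (simp add: T_def matrix_transpose_mul matrix_mul_assoc)
  have inv: "invertible T"
    unfolding gram using invertible_gram_plus_scaleR assms(2) .
  have "transpose T = T"
    \<comment> \<open>The Gram form makes the symmetry visible entrywise.\<close>
    unfolding gram by (simp add: transpose_def matrix_matrix_mult_def mat_def vec_eq_iff mult.commute)
  then have symm: "transpose (matrix_inv T) = matrix_inv T"
    using transpose_matrix_inv[OF inv] by simp
  have K: "K = matrix_inv T ** transpose A ** transpose X ** U"
    using assms(9) T_def by simp
  have M: "M = matrix_inv T ** transpose Z ** X"
    using assms(7) gram by simp
  have grad: "gradA = SigmaX ** A ** K"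
    unfolding assms(8) K M using symm
    by (simp add: assms(4,6) matrix_transpose_mul matrix_mul_assoc)
  have S: "subspace S"
    unfolding assms(10) col_space_def by simp
  \<comment> \<open>Here \<open>B\<close> is a fresh matrix, not the low-rank factor; it is
    instantiated below with both \<open>A\<close> and \<open>A'\<close>.\<close>
  have perp: "P_perp ** B = 0" if "col_space B \<subseteq> S" for B :: "real^'r^'m"
    using orth_projector_complement_mul_eq_0[OF S that] assms(11,12) by simp
  have step: "P_perp ** A' = - (eta *\<^sub>R (P_perp ** SigmaX ** A ** K))"
    using perp[of A] assms(10)
    by (simp add: assms(13) grad matrix_diff_ldistrib matrix_scalar_ac
        scalar_matrix_assoc[symmetric] matrix_mul_assoc)
  \<comment> \<open>By contradiction: the inclusion would give \<open>P_perp ** A' = 0\<close>, and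
    dividing \<open>step\<close> by the nonzero \<open>eta\<close> contradicts the
    assumption.\<close>
  have leaves: "\<not> col_space A' \<subseteq> col_space A" if "P_perp ** SigmaX ** A ** K \<noteq> 0"
    using perp[of A'] step that assms(3,10) by auto
  have "dim (col_space A') = rank A'"
    by (simp add: col_space_def column_rank_def)
  moreover have "subspace (col_space A')"
    by (simp add: col_space_def)
  ultimately show ?thesis
    using inv grad step leaves unfolding T_def by auto
qed

end
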